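(* Let $\tau = \tau_1\tau_2\tau_3\cdots = 01101001\cdots$ be the Thue--Morse sequence, where $\tau_n\in\{0,1\}$ is the parity of the number of $1$'s in the binary representation of $n-1$ (so $\tau_1=0$). If $\beta\ge 1$ is a real number, then for every integer $k\ge 0$, $\tau_1 \cdots \tau_{2^k} \leq_\beta \overline{\tau_1 \cdots\tau_{2^k}}$, where the overline denotes bitwise complement.
   Context: Let $\beta$ be a positive real number. The beta expansion of a bit string $\alpha=a_1\cdots a_\ell\in\{0,1\}^\ell$ is $\alpha_\beta=\sum_{i=1}^{\ell}a_i\beta^{\ell-i}$. For bit strings $\alpha,\gamma$, write $\alpha\ge_\beta\gamma$ (equivalently $\gamma\le_\beta\alpha$) if $\alpha_\beta\ge\gamma_\beta$. *)

theory Defs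
  imports Complex_Main
begin

text \<open>
  A bit string \<open>a\<^sub>1 \<dots> a\<^sub>l\<close> is a boolean list (\<open>True\<close> is the bit 1); \<open>a\<^sub>i\<close> is the
  list element at position \<open>i - 1\<close>, as lists are indexed from 0.
\<close>

definition beta_expansion :: "real \<Rightarrow> bool list \<Rightarrow> real" where
  "beta_expansion \<beta> \<alpha> = (\<Sum>i=1..length \<alpha>. of_bool (\<alpha> ! (i - 1)) * \<beta> ^ (length \<alpha> - i))"

definition beta_le :: "real \<Rightarrow> bool list \<Rightarrow> bool list \<Rightarrow> bool" where
  "beta_le \<beta> \<gamma> \<alpha> \<longleftrightarrow> beta_expansion \<beta> \<gamma> \<le> beta_expansion \<beta> \<alpha>"

text \<open>
  The sequence is indexed from 1; the value at 0 is irrelevant. The set of positions of the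
  binary digit 1 of a natural number is finite, so its cardinality is the number of these digits.
\<close>

definition thue_morse :: "nat \<Rightarrow> bool" where
  "thue_morse n \<longleftrightarrow> odd (card {j. bit (n - 1) j})"

definition thue_morse_prefix :: "nat \<Rightarrow> bool list" where
  "thue_morse_prefix m = map thue_morse [1..<m + 1]"

definition bit_complement :: "bool list \<Rightarrow> bool list" where
  "bit_complement \<alpha> = map Not \<alpha>"

end

theory Submission
  imports Defs
begin

text \<open>
  The expansion of the complement minus that of the prefix is the sum of
  \<open>(-1)\<^bsup>t(n)\<^esup> \<beta>\<^bsup>2^k-1-n\<^esup>\<close> over \<open>n < 2^k\<close>, where \<open>t(n)\<close> is the binary digit sum. As
  \<open>t(2^k + n) = t(n) + 1\<close> for \<open>n < 2^k\<close>, this sum factors as the product of \<open>\<beta>\<^bsup>2^j\<^esup> - 1\<close> over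
  \<open>j < k\<close>, all of whose factors are nonnegative.
\<close>

lemma bit_less_power_imp_less:
  fixes n :: nat
  assumes "n < 2 ^ k" "bit n j"
  shows "j < k"
  by (metis assms bit_take_bit_iff take_bit_nat_eq_self)

lemma card_bits_add_power:
  fixes n :: nat
  assumes "n < 2 ^ k"
  shows "card {j. bit (2 ^ k + n) j} = Suc (card {j. bit n j})"
proof -
  have sub: "{j. bit n j} \<subseteq> {..<k}"
    using bit_less_power_imp_less[OF assms] by auto
  \<comment> \<open>Bit \<open>k\<close> is clear in \<open>n\<close>, so the addition has no carry
    and is a bitwise or.\<close>
  have "2 ^ k + n = or (2 ^ k) n"
    using sub by (intro disjunctive_add_eq_or bit_eqI) (auto simp: bit_simps)
  then have "{j. bit (2 ^ k + n) j} = insert k {j. bit n j}"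
    by (auto simp: bit_simps)
  moreover have "finite {j. bit n j}" "k \<notin> {j. bit n j}"
    using sub finite_subset by blast+
  ultimately show ?thesis by simp
qed

lemma thue_morse_signed_sum:
  fixes x :: "'a :: comm_ring_1"
  shows "(\<Sum>n<2 ^ k. (-1) ^ card {j. bit n j} * x ^ (2 ^ k - Suc n)) = (\<Prod>j<k. x ^ 2 ^ j - 1)"
proof (induction k)
  case 0
  show ?case by simp
next
  case (Suc k)
  define f where "f K n = (-1) ^ card {j. bit n j} * x ^ (K - Suc n)" for K n :: nat
  let ?K = "2 ^ k :: nat"
  have "(\<Sum>n<2 * ?K. f (2 * ?K) n)
      = (\<Sum>n<?K. f (2 * ?K) n) + (\<Sum>n<?K. f (2 * ?K) (?K + n))"
    using sum.atLeastLessThan_concat[of 0 ?K "2 * ?K" "f (2 * ?K)"]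
      sum.shift_bounds_nat_ivl[of "f (2 * ?K)" 0 ?K ?K]
    by (simp add: lessThan_atLeast0 add.commute mult_2)
  \<comment> \<open>In the lower half the signs are those of the shorter sum and every exponent
    grows by \<open>?K\<close>.\<close>
  also have "(\<Sum>n<?K. f (2 * ?K) n) = x ^ ?K * (\<Sum>n<?K. f ?K n)"
    unfolding sum_distrib_left
  proof (rule sum.cong)
    fix n assume "n \<in> {..<?K}"
    then have "2 * ?K - Suc n = ?K + (?K - Suc n)" by simp
    then show "f (2 * ?K) n = x ^ ?K * f ?K n"
      by (simp add: f_def power_add)
  qed simp
  \<comment> \<open>In the upper half the exponents are those of the shorter sum, and the extra bit
    \<open>k\<close> flips every sign.\<close>
  also have "(\<Sum>n<?K. f (2 * ?K) (?K + n)) = - (\<Sum>n<?K. f ?K n)"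
    unfolding sum_negf[symmetric]
    by (rule sum.cong) (auto simp: f_def card_bits_add_power)
  finally show ?case
    using Suc.IH by (simp add: f_def algebra_simps)
qed

text \<open>A bit \<open>a\<close> contributes \<open>(1 - a) - a\<close>, which is 1 or -1, times
  its power of \<beta>.\<close>

lemma beta_expansion_complement_diff:
  "beta_expansion \<beta> (bit_complement \<alpha>) - beta_expansion \<beta> \<alpha>
    = (\<Sum>n<length \<alpha>. (if \<alpha> ! n then -1 else 1) * \<beta> ^ (length \<alpha> - Suc n))"
proof -
  have "beta_expansion \<beta> \<gamma> = (\<Sum>n<length \<gamma>. of_bool (\<gamma> ! n) * \<beta> ^ (length \<gamma> - Suc n))" for \<gamma>
    unfolding beta_expansion_def by (simp add: sum.atLeast1_atMost_eq del: sum_of_bool_mult_eq)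
  then show ?thesis
    by (auto simp: bit_complement_def sum_subtractf[symmetric]
        simp del: sum_of_bool_mult_eq intro!: sum.cong)
qed

theorem proposition36:
  fixes \<beta> :: real and k :: nat
  assumes "\<beta> \<ge> 1"
  shows "beta_le \<beta> (thue_morse_prefix (2 ^ k)) (bit_complement (thue_morse_prefix (2 ^ k)))"
proof -
  let ?p = "thue_morse_prefix (2 ^ k)"
  have "beta_expansion \<beta> (bit_complement ?p) - beta_expansion \<beta> ?p
      = (\<Sum>n<2 ^ k. (-1) ^ card {j. bit n j} * \<beta> ^ (2 ^ k - Suc n))"
    unfolding beta_expansion_complement_diff
    \<comment> \<open>The list element at \<open>n\<close> is \<open>thue_morse (n + 1)\<close>, the
      parity of the digit sum of \<open>n\<close>: the two shifts by one cancel.\<close>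
    by (rule sum.cong) (auto simp: thue_morse_prefix_def thue_morse_def simp del: upt_Suc)
  also have "\<dots> = (\<Prod>j<k. \<beta> ^ 2 ^ j - 1)"
    by (rule thue_morse_signed_sum)
  also have "\<dots> \<ge> 0"
    using assms by (intro prod_nonneg) simp
  finally show ?thesis
    by (simp add: beta_le_def)
qed

end
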